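(* Let $X$ be a real reflexive Banach space and let $C\subset X$ be a nonempty closed convex subset. If $C$ has the separation property and $\operatorname{bar}(C)=\operatorname{int}\operatorname{bar}(C)\cup\{0\}$, then $C$ has the strong separation property.
   Context: The barrier cone of $C$ is $\operatorname{bar}(C)=\{x^*\in X^*: \sup_{c\in C}\langle x^*,c\rangle<+\infty\}$; $\operatorname{int}$ is the interior in the norm topology of $X^*$. Convex sets $C,D\subset X$ are separated (respectively, strongly separated) if there exists $x^*\in X^*\setminus\{0\}$ with $\sup_{c\in C}\langle x^*,c\rangle\le\inf_{d\in D}\langle x^*,d\rangle$ (respectively, with strict inequality $<$). A convex set $C$ has the separation property (respectively, the strong separation property) if it is separated (respectively, strongly separated) from every nonempty closed convex subset $D$ of $X$ disjoint from $C$. *)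

theory Defs
  imports "HOL-Analysis.Analysis"
begin

text \<open>The dual space \<open>X\<^sup>*\<close> of \<open>X = 'a\<close> is \<open>'a \<Rightarrow>\<^sub>L real\<close> with the operator norm, so the
  library's \<^const>\<open>interior\<close> on it refers to the norm topology. Suprema and infima of real
  values are taken in the extended reals, since they may be infinite.\<close>

lift_definition bidual_embedding ::
  "'a::real_normed_vector \<Rightarrow> (('a \<Rightarrow>\<^sub>L real) \<Rightarrow>\<^sub>L real)"
  is "\<lambda>x f. blinfun_apply f x"
  by (rule blinfun.bounded_linear_left)

definition reflexive_space :: "'a::real_normed_vector itself \<Rightarrow> bool" where
  "reflexive_space _ \<longleftrightarrow>
     surj (bidual_embedding :: 'a \<Rightarrow> (('a \<Rightarrow>\<^sub>L real) \<Rightarrow>\<^sub>L real))"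

definition barrier_cone :: "'a::real_normed_vector set \<Rightarrow> ('a \<Rightarrow>\<^sub>L real) set" where
  "barrier_cone C = {f. (SUP c\<in>C. ereal (blinfun_apply f c)) < \<infinity>}"

definition separated :: "'a::real_normed_vector set \<Rightarrow> 'a set \<Rightarrow> bool" where
  "separated C D \<longleftrightarrow> (\<exists>f :: 'a \<Rightarrow>\<^sub>L real. f \<noteq> 0 \<and>
     (SUP c\<in>C. ereal (blinfun_apply f c)) \<le> (INF d\<in>D. ereal (blinfun_apply f d)))"

definition strongly_separated :: "'a::real_normed_vector set \<Rightarrow> 'a set \<Rightarrow> bool" where
  "strongly_separated C D \<longleftrightarrow> (\<exists>f :: 'a \<Rightarrow>\<^sub>L real. f \<noteq> 0 \<and>
     (SUP c\<in>C. ereal (blinfun_apply f c)) < (INF d\<in>D. ereal (blinfun_apply f d)))"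

definition separation_property :: "'a::real_normed_vector set \<Rightarrow> bool" where
  "separation_property C \<longleftrightarrow>
     (\<forall>D. D \<noteq> {} \<and> closed D \<and> convex D \<and> C \<inter> D = {} \<longrightarrow> separated C D)"

definition strong_separation_property :: "'a::real_normed_vector set \<Rightarrow> bool" where
  "strong_separation_property C \<longleftrightarrow>
     (\<forall>D. D \<noteq> {} \<and> closed D \<and> convex D \<and> C \<inter> D = {} \<longrightarrow> strongly_separated C D)"

end

theory Submission
  imports Defs
begin

text \<open>A functional \<open>f \<noteq> 0\<close> separating \<open>C\<close> from \<open>D\<close> lies in the barrier cone of \<open>C\<close>, hence in its
  interior. If \<open>C\<close> and \<open>D\<close> were not strongly separated, then by Hahn--Banach their distance would be
  zero, so \<open>d\<^sub>n - c\<^sub>n \<longlonglongrightarrow> 0\<close> for some \<open>c\<^sub>n \<in> C\<close> and \<open>d\<^sub>n \<in> D\<close>. The values \<open>f c\<^sub>n\<close> are bounded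
  below since \<open>f\<close> separates, and small perturbations of \<open>f\<close> in every direction remain
  bounded above on \<open>C\<close>; so \<open>(c\<^sub>n)\<close> is weakly bounded. By reflexivity it has a weak cluster point,
  which lies in both \<open>C\<close> and \<open>D\<close>.\<close>

section \<open>Sublinear functionals and the Hahn--Banach theorem\<close>

definition sublinear :: "('a::real_vector \<Rightarrow> real) \<Rightarrow> bool" where
  "sublinear p \<longleftrightarrow> (\<forall>x y. p (x + y) \<le> p x + p y) \<and> (\<forall>t x. 0 \<le> t \<longrightarrow> p (t *\<^sub>R x) = t * p x)"

lemma sublinear_add: "sublinear p \<Longrightarrow> p (x + y) \<le> p x + p y"
  by (simp add: sublinear_def)

lemma sublinear_scaleR: "sublinear p \<Longrightarrow> 0 \<le> t \<Longrightarrow> p (t *\<^sub>R x) = t * p x"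
  by (simp add: sublinear_def)

lemma sublinear_zero: "sublinear p \<Longrightarrow> p 0 = 0"
  using sublinear_scaleR[of p 0 0] by simp

lemma sublinear_minus: "sublinear p \<Longrightarrow> - p (- x) \<le> p x"
  using sublinear_add[of p x "- x"] sublinear_zero[of p] by simp

text \<open>For \<open>t > 0\<close> the reverse inequality comes from applying
  \<open>scaleR\<close> with factor \<open>inverse t\<close> at \<open>t *\<^sub>R x\<close>. At
  \<open>t = 0\<close>, halving gives \<open>p 0 \<le> 0\<close> and subadditivity gives
  \<open>0 \<le> p 0\<close>.\<close>

lemma sublinearI:
  assumes add: "\<And>x y. p (x + y) \<le> p x + p y"
    and scaleR: "\<And>t x. 0 < t \<Longrightarrow> p (t *\<^sub>R x) \<le> t * p x"
  shows "sublinear p"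
  unfolding sublinear_def
proof (intro conjI allI impI)
  fix t x assume t: "0 \<le> (t::real)"
  show "p (t *\<^sub>R x) = t * p x"
  proof (cases "t = 0")
    case True
    have "p 0 \<le> p 0 / 2"
      using scaleR[of "1/2" 0] by simp
    moreover have "0 \<le> p 0"
      using add[of 0 0] by simp
    ultimately show ?thesis
      using True by simp
  next
    case False
    then have "p x \<le> inverse t * p (t *\<^sub>R x)"
      using t scaleR[of "inverse t" "t *\<^sub>R x"] by simp
    then have "t * p x \<le> p (t *\<^sub>R x)"
      using False t by (simp add: field_simps)
    with scaleR[of t x] False t show ?thesis by simp
  qed
qed (rule add)

text \<open>Supplies the bounds of chains for Zorn's lemma. Of two members of a chain one lies below
  both, and its subadditivity estimates the infimum at \<open>x + y\<close> by
  \<open>q x + q' y\<close>.\<close>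

lemma sublinear_Inf_chain:
  fixes Q :: "('a::real_vector \<Rightarrow> real) set"
  assumes "Q \<noteq> {}" and sub: "\<And>q. q \<in> Q \<Longrightarrow> sublinear q"
    and chain: "\<And>q q'. q \<in> Q \<Longrightarrow> q' \<in> Q \<Longrightarrow> q \<le> q' \<or> q' \<le> q"
  shows "sublinear (\<lambda>x. INF q\<in>Q. q x)" (is "sublinear ?u")
    and "\<And>q x. q \<in> Q \<Longrightarrow> (INF q\<in>Q. q x) \<le> q x"
proof -
  obtain q0 where q0: "q0 \<in> Q" using \<open>Q \<noteq> {}\<close> by blast
  \<comment> \<open>One fixed \<open>q0\<close> bounds the whole chain: if \<open>q \<le> q0\<close>
    then \<open>q x \<ge> - q (- x) \<ge> - q0 (- x)\<close>, otherwise
    \<open>q x \<ge> q0 x \<ge> - q0 (- x)\<close>.\<close>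
  have "- q0 (- x) \<le> q x" if "q \<in> Q" for q x
    using chain[OF that q0] sublinear_minus[OF sub[OF that], of x] sublinear_minus[OF sub[OF q0], of x]
    by (meson le_funD minus_le_iff order_trans)
  then have bdd: "bdd_below ((\<lambda>q. q x) ` Q)" for x
    by (rule bdd_belowI2)
  show le: "?u x \<le> q x" if "q \<in> Q" for q x
    using that bdd by (intro cINF_lower)
  show "sublinear ?u"
  proof (rule sublinearI)
    fix x y
    have *: "?u (x + y) \<le> q x + q' y" if qq: "q \<in> Q" "q' \<in> Q" for q q'
    proof -
      obtain r where r: "r \<in> Q" "r \<le> q" "r \<le> q'"
        using chain[OF qq] qq by blast
      have "?u (x + y) \<le> r x + r y"
        using le[OF r(1), of "x + y"] sublinear_add[OF sub[OF r(1)], of x y] by linarith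
      then show ?thesis using r(2,3) by (smt (verit) le_funD)
    qed
    \<comment> \<open>The infima over \<open>q\<close> and over \<open>q'\<close> are taken one
      after the other.\<close>
    have "?u (x + y) - ?u x \<le> q' y" if q': "q' \<in> Q" for q'
    proof -
      have "?u (x + y) - q' y \<le> ?u x"
        using *[OF _ q'] \<open>Q \<noteq> {}\<close> by (intro cINF_greatest) (auto simp: algebra_simps)
      then show ?thesis by simp
    qed
    then have "?u (x + y) - ?u x \<le> ?u y"
      using \<open>Q \<noteq> {}\<close> by (intro cINF_greatest)
    then show "?u (x + y) \<le> ?u x + ?u y" by simp
  next
    fix t :: real and x assume t: "0 < t"
    have "?u (t *\<^sub>R x) / t \<le> q x" if "q \<in> Q" for q
      using le[OF that, of "t *\<^sub>R x"] sublinear_scaleR[OF sub[OF that], of t x] t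
      by (simp add: field_simps)
    then have "?u (t *\<^sub>R x) / t \<le> ?u x"
      using \<open>Q \<noteq> {}\<close> by (intro cINF_greatest)
    then show "?u (t *\<^sub>R x) \<le> t * ?u x"
      using t by (simp add: field_simps)
  qed
qed

text \<open>The minorant is \<open>q' x = inf {q (x + t s) - t r | t \<ge> 0, s \<in> S}\<close>. With \<open>S = {x}\<close> and
  \<open>r = q x\<close> it shows that minimal sublinear functionals are odd; with \<open>q = norm\<close> it yields the
  separation of a convex set from a ball.\<close>

lemma sublinear_minorant_convex:
  fixes q :: "'a::real_vector \<Rightarrow> real"
  assumes q: "sublinear q" and S: "convex S" "S \<noteq> {}" and r: "\<And>s. s \<in> S \<Longrightarrow> r \<le> q s"
  shows "\<exists>q'. sublinear q' \<and> q' \<le> q \<and> (\<forall>s\<in>S. q' (- s) \<le> - r)"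
proof -
  define A where "A x = {q (x + t *\<^sub>R s) - t * r | t s. 0 \<le> t \<and> s \<in> S}" for x
  define q' where "q' x = Inf (A x)" for x
  obtain s0 where s0: "s0 \<in> S" using S by blast
  have AI: "q (x + t *\<^sub>R s) - t * r \<in> A x" if "0 \<le> t" "s \<in> S" for x t s
    using that by (auto simp: A_def)
  have ne: "A x \<noteq> {}" for x using AI[of 0, OF _ s0] by auto
  \<comment> \<open>Since \<open>r \<le> q s\<close> on \<open>S\<close>, subtracting
    \<open>t * r\<close> cannot push the infimum to minus infinity.\<close>
  have "- q (- x) \<le> a" if "a \<in> A x" for a x
  proof -
    obtain t s where a: "a = q (x + t *\<^sub>R s) - t * r" and ts: "0 \<le> t" "s \<in> S"
      using \<open>a \<in> A x\<close> by (auto simp: A_def)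
    have "t * r \<le> q (t *\<^sub>R s)"
      using ts r[of s] by (simp add: sublinear_scaleR[OF q] mult_left_mono)
    also have "\<dots> \<le> q (x + t *\<^sub>R s) + q (- x)"
      using sublinear_add[OF q, of "x + t *\<^sub>R s" "- x"] by simp
    finally show ?thesis using a by simp
  qed
  then have bdd: "bdd_below (A x)" for x by (rule bdd_belowI)
  have le: "q' x \<le> q (x + t *\<^sub>R s) - t * r" if "0 \<le> t" "s \<in> S" for x t s
    unfolding q'_def by (intro cInf_lower AI that bdd)
  have "sublinear q'"
  proof (rule sublinearI)
    fix x y
    have *: "q' (x + y) \<le> a + b" if "a \<in> A x" "b \<in> A y" for a b
    proof -
      obtain t s where a: "a = q (x + t *\<^sub>R s) - t * r" and ts: "0 \<le> t" "s \<in> S"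
        using \<open>a \<in> A x\<close> by (auto simp: A_def)
      obtain u s' where b: "b = q (y + u *\<^sub>R s') - u * r" and us: "0 \<le> u" "s' \<in> S"
        using \<open>b \<in> A y\<close> by (auto simp: A_def)
      \<comment> \<open>Convexity enters here: the two shifts merge into one shift by a multiple of
        a single point of \<open>S\<close>. If \<open>t = u = 0\<close>, any point will do.\<close>
      obtain w where w: "w \<in> S" "(t + u) *\<^sub>R w = t *\<^sub>R s + u *\<^sub>R s'"
      proof (cases "t + u = 0")
        case True
        then have "t = 0" "u = 0" using ts us by linarith+
        then show ?thesis using that[OF s0] by simp
      next
        case False
        show ?thesis
        proof (rule that)
          show "(t / (t + u)) *\<^sub>R s + (u / (t + u)) *\<^sub>R s' \<in> S"
            using False ts us by (intro convexD[OF S(1)]) (simp_all add: add_divide_distrib[symmetric])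
          show "(t + u) *\<^sub>R ((t / (t + u)) *\<^sub>R s + (u / (t + u)) *\<^sub>R s') = t *\<^sub>R s + u *\<^sub>R s'"
            using False by (simp add: scaleR_add_right)
        qed
      qed
      have "q' (x + y) \<le> q ((x + y) + (t + u) *\<^sub>R w) - (t + u) * r"
        using ts us w by (intro le) auto
      also have "(x + y) + (t + u) *\<^sub>R w = (x + t *\<^sub>R s) + (y + u *\<^sub>R s')"
        using w by simp
      also have "q \<dots> \<le> q (x + t *\<^sub>R s) + q (y + u *\<^sub>R s')"
        by (rule sublinear_add[OF q])
      finally show ?thesis by (simp add: a b algebra_simps)
    qed
    have "q' (x + y) - q' x \<le> b" if b: "b \<in> A y" for b
    proof -
      have "q' (x + y) - b \<le> q' x"
        unfolding q'_def[of x] using *[OF _ b] ne by (intro cInf_greatest) (auto simp: algebra_simps)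
      then show ?thesis by simp
    qed
    then have "q' (x + y) - q' x \<le> q' y"
      unfolding q'_def[of y] using ne by (intro cInf_greatest)
    then show "q' (x + y) \<le> q' x + q' y" by simp
  next
    fix t :: real and x assume t: "0 < t"
    have "q' (t *\<^sub>R x) / t \<le> a" if "a \<in> A x" for a
    proof -
      obtain u s where a: "a = q (x + u *\<^sub>R s) - u * r" and us: "0 \<le> u" "s \<in> S"
        using \<open>a \<in> A x\<close> by (auto simp: A_def)
      have "q' (t *\<^sub>R x) \<le> q (t *\<^sub>R x + (t * u) *\<^sub>R s) - t * u * r"
        using t us by (intro le) auto
      also have "t *\<^sub>R x + (t * u) *\<^sub>R s = t *\<^sub>R (x + u *\<^sub>R s)"
        by (simp add: scaleR_add_right)
      also have "q \<dots> - t * u * r = t * a"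
        using t by (simp add: a sublinear_scaleR[OF q] right_diff_distrib del: scaleR_add_right)
      finally show ?thesis using t by (simp add: field_simps)
    qed
    then have "q' (t *\<^sub>R x) / t \<le> q' x"
      unfolding q'_def[of x] using ne by (intro cInf_greatest)
    then show "q' (t *\<^sub>R x) \<le> t * q' x"
      using t by (simp add: field_simps)
  qed
  moreover have "q' \<le> q"
    using le[of 0, OF _ s0] by (simp add: le_fun_def)
  \<comment> \<open>With \<open>t = 1\<close> the shift cancels \<open>- s\<close>, leaving
    \<open>q 0 - r\<close>.\<close>
  moreover have "q' (- s) \<le> - r" if "s \<in> S" for s
    using le[of 1, OF _ that, of "- s"] by (simp add: sublinear_zero[OF q])
  ultimately show ?thesis by blast
qed

text \<open>Oddness turns subadditivity at \<open>- x\<close> and \<open>- y\<close> into the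
  reverse inequality and carries homogeneity over to negative scalars.\<close>

lemma linear_if_sublinear_minimal:
  fixes q :: "'a::real_vector \<Rightarrow> real"
  assumes q: "sublinear q" and min: "\<And>q'. sublinear q' \<Longrightarrow> q' \<le> q \<Longrightarrow> q' = q"
  shows "linear q"
proof -
  have odd: "q (- x) = - q x" for x
  proof -
    obtain q' where "sublinear q'" "q' \<le> q" "q' (- x) \<le> - q x"
      using sublinear_minorant_convex[OF q, of "{x}" "q x"] by auto
    then have "q (- x) \<le> - q x" using min[of q'] by simp
    then show ?thesis using sublinear_minus[OF q, of x] by simp
  qed
  show ?thesis
  proof (rule linearI)
    fix x y
    show "q (x + y) = q x + q y"
      using sublinear_add[OF q, of x y] sublinear_add[OF q, of "- x" "- y"] odd[of x] odd[of y] odd[of "x + y"]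
      by simp
  next
    fix t x
    show "q (t *\<^sub>R x) = t *\<^sub>R q x"
    proof (cases "0 \<le> t")
      case True
      then show ?thesis by (simp add: sublinear_scaleR[OF q])
    next
      case False
      then have "q ((- t) *\<^sub>R x) = - t * q x" by (intro sublinear_scaleR[OF q]) simp
      then show ?thesis using odd[of "t *\<^sub>R x"] by simp
    qed
  qed
qed

theorem sublinear_dominates_linear:
  fixes p :: "'a::real_vector \<Rightarrow> real"
  assumes p: "sublinear p"
  obtains \<phi> where "linear \<phi>" "\<phi> \<le> p"
proof -
  define A where "A = {q. sublinear q \<and> q \<le> p}"
  \<comment> \<open>Zorn's lemma is applied to the reversed order, so that it yields a minimal
    sublinear functional below \<open>p\<close>.\<close>
  have "\<exists>m\<in>A. \<forall>a\<in>A. a \<le> m \<longrightarrow> a = m"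
  proof (rule predicate_Zorn)
    show "partial_order_on A (relation_of (\<lambda>a b. b \<le> a) A)"
      by (rule partial_order_on_relation_ofI) auto
  next
    fix Q assume "Q \<in> Chains (relation_of (\<lambda>a b. b \<le> a) A)"
    then have Q: "Q \<subseteq> A" and chain: "\<And>q q'. q \<in> Q \<Longrightarrow> q' \<in> Q \<Longrightarrow> q \<le> q' \<or> q' \<le> q"
      by (auto simp: Chains_def relation_of_def)
    show "\<exists>u\<in>A. \<forall>a\<in>Q. u \<le> a"
    \<comment> \<open>The empty chain has no meaningful pointwise infimum; \<open>p\<close> itself
      bounds it.\<close>
    proof (cases "Q = {}")
      case True
      then show ?thesis using p by (auto simp: A_def)
    next
      case False
      let ?u = "\<lambda>x. INF q\<in>Q. q x"
      have sub: "sublinear q" if "q \<in> Q" for q using Q that by (auto simp: A_def)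
      note u = sublinear_Inf_chain[OF False sub chain]
      have le: "?u \<le> q" if "q \<in> Q" for q
        using u(2) that by (auto simp: le_fun_def)
      moreover have "?u \<in> A"
      proof -
        obtain q where "q \<in> Q" using False by blast
        then have "?u \<le> p" using le[of q] Q by (force simp: A_def)
        then show ?thesis using u(1) by (simp add: A_def)
      qed
      ultimately show ?thesis by blast
    qed
  qed
  then obtain m where m: "m \<in> A" and min: "\<And>a. a \<in> A \<Longrightarrow> a \<le> m \<Longrightarrow> a = m" by blast
  then have "linear m"
    by (intro linear_if_sublinear_minimal) (auto simp: A_def intro: min order_trans)
  then show thesis using that m by (auto simp: A_def)
qed

text \<open>A linear \<phi> below the minorant \<open>q\<close> satisfies
  \<open>\<phi> (- s) \<le> - r\<close>, which is the claim after a sign change; since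
  \<open>q \<le> norm\<close>, it is continuous.\<close>

lemma separate_convex_from_ball:
  fixes S :: "'a::real_normed_vector set"
  assumes "convex S" "S \<noteq> {}" and r: "\<And>s. s \<in> S \<Longrightarrow> r \<le> norm s"
  obtains g :: "'a \<Rightarrow>\<^sub>L real" where "\<And>s. s \<in> S \<Longrightarrow> r \<le> g s"
proof -
  have "sublinear (norm :: 'a \<Rightarrow> real)"
    by (auto simp: sublinear_def norm_triangle_ineq)
  then obtain q where q: "sublinear q" "q \<le> norm" "\<And>s. s \<in> S \<Longrightarrow> q (- s) \<le> - r"
    using sublinear_minorant_convex[OF _ assms(1,2), of norm r] r by blast
  obtain \<phi> where \<phi>: "linear \<phi>" "\<phi> \<le> q"
    using sublinear_dominates_linear[OF q(1)] .
  have le: "\<phi> x \<le> norm x" for x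
    using order_trans[OF \<phi>(2) q(2)] by (simp add: le_fun_def)
  have "bounded_linear \<phi>"
  proof (rule bounded_linear_intro)
    show "norm (\<phi> x) \<le> norm x * 1" for x
      using le[of x] le[of "- x"] by (simp add: linear_neg[OF \<phi>(1)])
  qed (simp_all add: linear_add[OF \<phi>(1)] linear_cmul[OF \<phi>(1)])
  then have "r \<le> Blinfun \<phi> s" if "s \<in> S" for s
    using le_funD[OF \<phi>(2), of "- s"] q(3)[OF that]
    by (simp add: bounded_linear_Blinfun_apply linear_neg[OF \<phi>(1)])
  then show thesis by (rule that)
qed

text \<open>Mazur's argument that closed convex sets are weakly closed. The last hypothesis replaces
  weak convergence: \<open>g x\<close> is at most the limsup of \<open>g (X n)\<close> for every
  \<open>g\<close>.\<close>

lemma closed_convex_mem_if_weak_cluster: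
  fixes S :: "'a::real_normed_vector set"
  assumes S: "closed S" "convex S" and X: "\<And>n. X n \<in> S"
    and x: "\<And>(g :: 'a \<Rightarrow>\<^sub>L real) b. eventually (\<lambda>n. g (X n) \<le> b) sequentially \<Longrightarrow> g x \<le> b"
  shows "x \<in> S"
proof (rule ccontr)
  assume "x \<notin> S"
  moreover have "open (- S)" using S by blast
  ultimately obtain r where r: "r > 0" "ball x r \<subseteq> - S"
    by (meson ComplI open_contains_ball)
  have "convex ((\<lambda>s. s - x) ` S)" using S(2) by (rule convex_translation_subtract)
  moreover have "(\<lambda>s. s - x) ` S \<noteq> {}" using X by blast
  moreover have "r \<le> norm s" if "s \<in> (\<lambda>s. s - x) ` S" for s
    using that r(2) by (force simp: dist_norm norm_minus_commute)
  ultimately obtain g :: "'a \<Rightarrow>\<^sub>L real" where "\<And>s. s \<in> (\<lambda>s. s - x) ` S \<Longrightarrow> r \<le> g s"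
    using separate_convex_from_ball by blast
  then have "r \<le> g (X n - x)" for n using X by blast
  \<comment> \<open>The hypothesis on \<open>x\<close> speaks of upper bounds, hence the passage to
    \<open>- g\<close>.\<close>
  then have "(- g) (X n) \<le> (- g) x - r" for n
    by (simp add: blinfun.diff_right uminus_blinfun.rep_eq algebra_simps)
  then have "(- g) x \<le> (- g) x - r" by (intro x) auto
  with r(1) show False by simp
qed

section \<open>Weak cluster points in reflexive spaces\<close>

text \<open>The uniform boundedness principle for the evaluations at \<open>X n\<close>. They act on
  the dual, which is complete, so Baire's theorem gives some \<open>E k\<close> an interior
  point.\<close>

lemma pointwise_bounded_imp_equicontinuous:
  fixes X :: "nat \<Rightarrow> 'a::real_normed_vector"
  assumes "\<And>g :: 'a \<Rightarrow>\<^sub>L real. \<exists>b. \<forall>n. \<bar>g (X n)\<bar> \<le> b"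
  obtains K where "\<And>(g :: 'a \<Rightarrow>\<^sub>L real) n. \<bar>blinfun_apply g (X n)\<bar> \<le> norm g * K"
proof -
  define E where "E k = {g :: 'a \<Rightarrow>\<^sub>L real. \<forall>n. \<bar>g (X n)\<bar> \<le> real k}" for k
  have closed: "closed (E k)" for k
    unfolding E_def
    by (intro closed_Collect_all closed_Collect_le continuous_intros)
  have UN: "(\<Union>k. E k) = UNIV"
  proof -
    have "\<exists>k. g \<in> E k" for g
    proof -
      obtain b where b: "\<And>n. \<bar>g (X n)\<bar> \<le> b" using assms by blast
      obtain k where "b \<le> real k" using real_arch_simple by blast
      then have "g \<in> E k" using b by (auto simp: E_def intro: order_trans)
      then show ?thesis ..
    qed
    then show ?thesis by blast
  qed
  obtain k where k: "interior (E k) \<noteq> {}"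
  proof (rule ccontr)
    assume "\<not> thesis"
    with that have emp: "interior (E k) = {}" for k by blast
    have "Met_TC.mtopology interior_of \<Union>(range E) = {}"
    proof (rule Met_TC.metric_Baire_category_alt)
      show "Met_TC.mcomplete (TYPE('a \<Rightarrow>\<^sub>L real))"
        by (simp add: complete_UNIV)
    next
      fix T assume "T \<in> range E"
      then show "closedin Met_TC.mtopology T \<and> Met_TC.mtopology interior_of T = {}"
        using closed emp by auto
    qed auto
    then show False using UN by simp
  qed
  then obtain g0 e where e: "e > 0" "cball g0 e \<subseteq> E k"
    by (metis equals0I interior_subset mem_interior_cball subset_empty all_not_in_conv)
  have "\<bar>blinfun_apply g (X n)\<bar> \<le> norm g * (2 * real k / e)" for g :: "'a \<Rightarrow>\<^sub>L real" and n
  proof (cases "g = 0")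
    case False
    \<comment> \<open>This scaling gives \<open>c *\<^sub>R g\<close> norm \<open>e\<close>, so the
      step from \<open>g0\<close> stays in the ball; both endpoints have values at most
      \<open>k\<close>, whence the factor 2.\<close>
    define c where "c = e / norm g"
    have c: "c > 0" using e False by (simp add: c_def)
    have "g0 + c *\<^sub>R g \<in> cball g0 e" using e False by (simp add: dist_norm c_def)
    then have "\<bar>(g0 + c *\<^sub>R g) (X n)\<bar> \<le> real k" using e(2) by (auto simp: E_def)
    moreover have "\<bar>g0 (X n)\<bar> \<le> real k"
      using e by (force simp: E_def)
    ultimately have "\<bar>c * g (X n)\<bar> \<le> 2 * real k"
      by (simp add: blinfun.add_left blinfun.scaleR_left)
    then show ?thesis using c e False by (simp add: abs_mult c_def field_simps)
  qed simp
  then show thesis by (rule that)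
qed

text \<open>A linear functional on the dual below \<open>g \<mapsto> limsup (g (X n))\<close> replaces the extraction of
  a weakly convergent subsequence; by reflexivity it is evaluation at some \<open>x\<close>.\<close>

lemma reflexive_weak_cluster_point:
  fixes X :: "nat \<Rightarrow> 'a::real_normed_vector"
  assumes refl: "reflexive_space TYPE('a)"
    and bdd: "\<And>g :: 'a \<Rightarrow>\<^sub>L real. \<exists>b. \<forall>n. \<bar>g (X n)\<bar> \<le> b"
  obtains x where "\<And>(g :: 'a \<Rightarrow>\<^sub>L real) b. eventually (\<lambda>n. g (X n) \<le> b) sequentially \<Longrightarrow> g x \<le> b"
proof -
  obtain K where K: "\<And>(g :: 'a \<Rightarrow>\<^sub>L real) n. \<bar>blinfun_apply g (X n)\<bar> \<le> norm g * K"
    using pointwise_bounded_imp_equicontinuous[OF bdd] by blast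
  \<comment> \<open>\<open>A g\<close> collects the eventual upper bounds, so its infimum
    \<open>p g\<close> is the limsup of \<open>g (X n)\<close>.\<close>
  define A where "A g = {b. eventually (\<lambda>n. g (X n) \<le> b) sequentially}" for g :: "'a \<Rightarrow>\<^sub>L real"
  define p where "p g = Inf (A g)" for g
  have K_in: "norm g * K \<in> A g" for g
    using K[of g] by (auto simp: A_def abs_le_iff)
  then have ne: "A g \<noteq> {}" for g by blast
  have "- (norm g * K) \<le> b" if b: "b \<in> A g" for g b
  proof -
    obtain n where "g (X n) \<le> b"
      using b eventually_happens'[OF sequentially_bot, of "\<lambda>n. g (X n) \<le> b"]
      by (auto simp: A_def)
    then show ?thesis using K[of g n] by linarith
  qed
  then have bdd_A: "bdd_below (A g)" for g by (rule bdd_belowI)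
  have p_le: "p g \<le> b" if "b \<in> A g" for g b
    unfolding p_def using that bdd_A by (rule cInf_lower)
  have "sublinear p"
  proof (rule sublinearI)
    fix g h
    have *: "p (g + h) \<le> a + b" if "a \<in> A g" "b \<in> A h" for a b
    proof (rule p_le)
      have "eventually (\<lambda>n. g (X n) \<le> a \<and> h (X n) \<le> b) sequentially"
        using that by (simp add: A_def eventually_conj)
      then show "a + b \<in> A (g + h)"
        unfolding A_def by (auto elim!: eventually_mono simp: blinfun.add_left)
    qed
    have "p (g + h) - p g \<le> b" if b: "b \<in> A h" for b
    proof -
      have "p (g + h) - b \<le> p g"
        unfolding p_def[of g] using *[OF _ b] ne by (intro cInf_greatest) (auto simp: algebra_simps)
      then show ?thesis by simp
    qed
    then have "p (g + h) - p g \<le> p h"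
      unfolding p_def[of h] using ne by (intro cInf_greatest)
    then show "p (g + h) \<le> p g + p h" by simp
  next
    fix t :: real and g assume t: "0 < t"
    have "p (t *\<^sub>R g) / t \<le> b" if "b \<in> A g" for b
    proof -
      have "t * b \<in> A (t *\<^sub>R g)"
        using that t by (simp add: A_def blinfun.scaleR_left)
      then show ?thesis using p_le t by (fastforce simp: field_simps)
    qed
    then have "p (t *\<^sub>R g) / t \<le> p g"
      unfolding p_def[of g] using ne by (intro cInf_greatest)
    then show "p (t *\<^sub>R g) \<le> t * p g"
      using t by (simp add: field_simps)
  qed
  then obtain \<phi> where \<phi>: "linear \<phi>" "\<phi> \<le> p"
    by (rule sublinear_dominates_linear)
  have le: "\<phi> g \<le> b" if "b \<in> A g" for g b
    using le_funD[OF \<phi>(2), of g] p_le[OF that] by simp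
  \<comment> \<open>Reflexivity represents only continuous functionals. The bound
    \<open>norm g * K\<close> lies in both \<open>A g\<close> and \<open>A (- g)\<close>, which
    controls \<phi> from both sides.\<close>
  have "bounded_linear \<phi>"
  proof (rule bounded_linear_intro)
    show "norm (\<phi> g) \<le> norm g * K" for g
      using le[OF K_in, of g] le[OF K_in, of "- g"] by (simp add: linear_neg[OF \<phi>(1)])
  qed (simp_all add: linear_add[OF \<phi>(1)] linear_cmul[OF \<phi>(1)])
  moreover obtain x :: 'a where x: "bidual_embedding x = Blinfun \<phi>"
    using refl unfolding reflexive_space_def by (metis surj_def)
  ultimately have "blinfun_apply g x = \<phi> g" for g
    by (metis bidual_embedding.rep_eq bounded_linear_Blinfun_apply)
  then show thesis using le by (intro that[of x]) (simp add: A_def)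
qed

section \<open>Separation\<close>

lemma barrier_cone_iff:
  fixes C :: "'a::real_normed_vector set"
  assumes "C \<noteq> {}"
  shows "f \<in> barrier_cone C \<longleftrightarrow> bdd_above (blinfun_apply f ` C)"
proof
  assume "f \<in> barrier_cone C"
  then obtain b :: real where "(SUP c\<in>C. ereal (f c)) < ereal b"
    unfolding barrier_cone_def using less_PInf_Ex_of_nat by auto
  then show "bdd_above (blinfun_apply f ` C)"
    by (intro bdd_aboveI2[of _ _ b]) (metis SUP_upper ereal_less_eq(3) less_imp_le order_trans)
next
  assume "bdd_above (blinfun_apply f ` C)"
  then obtain b where "\<And>c. c \<in> C \<Longrightarrow> f c \<le> b" by (auto simp: bdd_above_def)
  then have "(SUP c\<in>C. ereal (f c)) \<le> ereal b" by (intro SUP_least) simp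
  then show "f \<in> barrier_cone C" by (auto simp: barrier_cone_def)
qed

text \<open>Some \<open>f + c *\<^sub>R h\<close> with \<open>c > 0\<close> is still bounded above
  on \<open>C\<close>; subtracting the lower bound \<open>a\<close> of \<open>f\<close> along
  \<open>X\<close> bounds \<open>h\<close> above. Taking \<open>h = g\<close> and
  \<open>h = - g\<close> gives both sides.\<close>

lemma bounded_if_interior_barrier_cone:
  fixes C :: "'a::real_normed_vector set" and f g :: "'a \<Rightarrow>\<^sub>L real"
  assumes "C \<noteq> {}" and f: "f \<in> interior (barrier_cone C)"
    and X: "\<And>n. X n \<in> C" and low: "\<And>n. a \<le> f (X n)"
  shows "\<exists>b. \<forall>n. \<bar>g (X n)\<bar> \<le> b"
proof -
  obtain e where e: "e > 0" "cball f e \<subseteq> barrier_cone C"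
    using f by (auto simp: mem_interior_cball)
  have up: "\<exists>b. \<forall>n. h (X n) \<le> b" for h :: "'a \<Rightarrow>\<^sub>L real"
  proof (cases "h = 0")
    case False
    define c where "c = e / norm h"
    have c: "c > 0" using e False by (simp add: c_def)
    have "f + c *\<^sub>R h \<in> cball f e" using e False by (simp add: dist_norm c_def)
    then have "bdd_above (blinfun_apply (f + c *\<^sub>R h) ` C)"
      using subsetD[OF e(2)] barrier_cone_iff[OF \<open>C \<noteq> {}\<close>] by metis
    then obtain b where "\<And>x. x \<in> C \<Longrightarrow> (f + c *\<^sub>R h) x \<le> b"
      by (auto simp: bdd_above_def)
    then have "f (X n) + c * h (X n) \<le> b" for n
      using X by (simp add: blinfun.add_left blinfun.scaleR_left)
    then have "c * h (X n) \<le> b - a" for n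
      using low[of n] by (smt (verit))
    then have "h (X n) \<le> (b - a) / c" for n
      using c by (simp add: field_simps)
    then show ?thesis by blast
  qed auto
  obtain b1 where "\<And>n. g (X n) \<le> b1" using up[of g] by blast
  moreover obtain b2 where "\<And>n. (- g) (X n) \<le> b2" using up[of "- g"] by blast
  ultimately have "\<bar>g (X n)\<bar> \<le> max b1 b2" for n
    unfolding abs_le_iff
    by (auto simp: uminus_blinfun.rep_eq intro: max.coboundedI1 max.coboundedI2)
  then show ?thesis by blast
qed

text \<open>The difference set \<open>D - C\<close> is convex and stays at distance \<open>r\<close>
  from the origin; a functional that is at least \<open>r\<close> on it leaves a gap of
  \<open>r\<close> between \<open>C\<close> and \<open>D\<close>.\<close>

lemma strongly_separated_if_dist_pos:
  fixes C D :: "'a::real_normed_vector set"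
  assumes C: "C \<noteq> {}" "convex C" and D: "D \<noteq> {}" "convex D"
    and r: "r > 0" "\<And>c d. c \<in> C \<Longrightarrow> d \<in> D \<Longrightarrow> r \<le> norm (d - c)"
  shows "strongly_separated C D"
proof -
  let ?S = "\<Union>d\<in>D. \<Union>c\<in>C. {d - c}"
  have "convex ?S" using D(2) C(2) by (rule convex_differences)
  moreover have "?S \<noteq> {}" using C D by blast
  ultimately obtain g :: "'a \<Rightarrow>\<^sub>L real" where "\<And>s. s \<in> ?S \<Longrightarrow> r \<le> g s"
    using separate_convex_from_ball[of ?S r] r(2) by blast
  then have g: "r \<le> g d - g c" if "c \<in> C" "d \<in> D" for c d
    using that by (force simp: blinfun.diff_right)
  obtain c0 d0 where c0: "c0 \<in> C" and d0: "d0 \<in> D" using C D by blast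
  define m where "m = (SUP c\<in>C. g c)"
  have bdd: "bdd_above (g ` C)" using g[OF _ d0] by (intro bdd_aboveI2[of _ _ "g d0 - r"]) force
  have "m + r \<le> g d" if "d \<in> D" for d
  proof -
    have "m \<le> g d - r"
      unfolding m_def using g[OF _ that] C(1) by (intro cSUP_least) (auto simp: algebra_simps)
    then show ?thesis by simp
  qed
  then have "ereal (m + r) \<le> (INF d\<in>D. ereal (g d))" by (intro INF_greatest) simp
  moreover have "(SUP c\<in>C. ereal (g c)) \<le> ereal m"
    unfolding m_def by (intro SUP_least) (simp add: cSUP_upper bdd)
  moreover have "ereal m < ereal (m + r)" using r(1) by simp
  ultimately have "(SUP c\<in>C. ereal (g c)) < (INF d\<in>D. ereal (g d))" by (meson order.strict_trans1 order.strict_trans2)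
  moreover have "g \<noteq> 0" using g[OF c0 d0] r(1) by auto
  ultimately show ?thesis unfolding strongly_separated_def by blast
qed

theorem theorem10:
  fixes C :: "'a::banach set"
  assumes "reflexive_space TYPE('a)"
    and "C \<noteq> {}" and "closed C" and "convex C"
    and "separation_property C"
    and "barrier_cone C = interior (barrier_cone C) \<union> {0}"
  shows "strong_separation_property C"
  unfolding strong_separation_property_def
proof (intro allI impI, elim conjE)
  fix D :: "'a set"
  assume D: "D \<noteq> {}" "closed D" "convex D" and disj: "C \<inter> D = {}"
  have "separated C D"
    using assms(5) D disj by (simp add: separation_property_def)
  then obtain f :: "'a \<Rightarrow>\<^sub>L real" where "f \<noteq> 0"
    and le: "(SUP c\<in>C. ereal (f c)) \<le> (INF d\<in>D. ereal (f d))"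
    unfolding separated_def by (elim exE conjE)
  have f: "f c \<le> f d" if "c \<in> C" "d \<in> D" for c d
  proof -
    have "ereal (f c) \<le> ereal (f d)"
      using le SUP_upper[OF that(1), of "\<lambda>c. ereal (f c)"] INF_lower[OF that(2), of "\<lambda>d. ereal (f d)"]
      by (meson order_trans)
    then show ?thesis by simp
  qed
  obtain c0 d0 where c0: "c0 \<in> C" and d0: "d0 \<in> D" using assms(2) D(1) by blast
  \<comment> \<open>\<open>f\<close> is bounded above on \<open>C\<close> by \<open>f d0\<close>;
    being nonzero, it then falls into the interior part of the cone.\<close>
  have "f \<in> barrier_cone C"
    unfolding barrier_cone_iff[OF assms(2)] using f[OF _ d0] by (intro bdd_aboveI2[of _ _ "f d0"])
  with \<open>f \<noteq> 0\<close> assms(6) have int: "f \<in> interior (barrier_cone C)" by blast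
  show "strongly_separated C D"
  proof (rule ccontr)
    assume "\<not> strongly_separated C D"
    then have "\<exists>c\<in>C. \<exists>d\<in>D. norm (d - c) < 1 / Suc n" for n
      using strongly_separated_if_dist_pos[OF assms(2,4) D(1,3), of "1 / Suc n"]
      by (force simp: not_less)
    then obtain X Y where X: "\<And>n. X n \<in> C" and Y: "\<And>n. Y n \<in> D"
      and XY: "\<And>n. norm (Y n - X n) < 1 / Suc n"
      by metis
    have diff: "\<bar>blinfun_apply g (Y n) - blinfun_apply g (X n)\<bar> \<le> norm g / Suc n" for g :: "'a \<Rightarrow>\<^sub>L real" and n
    proof -
      have "\<bar>g (Y n - X n)\<bar> \<le> norm g * norm (Y n - X n)"
        using norm_blinfun[of g "Y n - X n"] by simp
      also have "\<dots> \<le> norm g * (1 / Suc n)"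
        using XY[of n] by (intro mult_left_mono) auto
      finally show ?thesis by (simp add: blinfun.diff_right)
    qed
    \<comment> \<open>Separation gives \<open>f c0 \<le> f (Y n)\<close>, and passing from
      \<open>Y n\<close> to \<open>X n\<close> costs at most \<open>norm f\<close>.\<close>
    have "f c0 - norm f \<le> blinfun_apply f (X n)" for n
    proof -
      have "norm f / Suc n \<le> norm f" by (simp add: field_simps)
      then show ?thesis using diff[of f n] f[OF c0 Y[of n]] by linarith
    qed
    then have "\<exists>b. \<forall>n. \<bar>g (X n)\<bar> \<le> b" for g :: "'a \<Rightarrow>\<^sub>L real"
      by (rule bounded_if_interior_barrier_cone[OF assms(2) int X])
    then obtain x where x: "\<And>(g :: 'a \<Rightarrow>\<^sub>L real) b. eventually (\<lambda>n. g (X n) \<le> b) sequentially \<Longrightarrow> g x \<le> b"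
      using reflexive_weak_cluster_point[OF assms(1)] by blast
    have "x \<in> C"
      using assms(3,4) X x by (rule closed_convex_mem_if_weak_cluster)
    moreover have "x \<in> D"
      using D(2,3) Y
    proof (rule closed_convex_mem_if_weak_cluster)
      fix g :: "'a \<Rightarrow>\<^sub>L real" and b
      assume b: "eventually (\<lambda>n. g (Y n) \<le> b) sequentially"
      \<comment> \<open>The point \<open>x\<close> was obtained from \<open>X\<close> alone. An
        eventual bound \<open>b\<close> along \<open>Y\<close> becomes \<open>b + e\<close> along
        \<open>X\<close> for every \<open>e > 0\<close>, because \<open>Y n - X n\<close> tends to
        0.\<close>
      show "g x \<le> b"
      proof (rule field_le_epsilon)
        fix e :: real assume "e > 0"
        have "(\<lambda>n. norm g / Suc n) \<longlonglongrightarrow> 0" by (rule LIMSEQ_Suc[OF lim_const_over_n])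
        then have "eventually (\<lambda>n. norm g / Suc n < e) sequentially"
          using \<open>e > 0\<close> by (rule order_tendstoD)
        with b have "eventually (\<lambda>n. g (X n) \<le> b + e) sequentially"
        proof eventually_elim
          case (elim n)
          then show ?case using diff[of g n] by linarith
        qed
        then show "g x \<le> b + e" by (rule x)
      qed
    qed
    ultimately show False using disj by blast
  qed
qed

end
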